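(* For every integer $n \ge 3$ we have $g_3(n) = 1$.
   Context: For positive integers $n$ and $k \ge 3$, $g_k(n)$ denotes the smallest integer such that for every set $A \subseteq \{1, 2, \ldots, 2n\}$ with $|A| \ge n + g_k(n)$ there exist pairwise distinct integers $b_1, \ldots, b_k$ (arbitrary integers, not required to be positive or to lie in $A$) with $b_i + b_j \in A$ for all $1 \le i < j \le k$. *)

theory Defs
  imports Main
begin

definition has_pairwise_sums :: "nat \<Rightarrow> int set \<Rightarrow> bool" where
  "has_pairwise_sums k A \<longleftrightarrow>
     (\<exists>b :: nat \<Rightarrow> int. inj_on b {1..k} \<and>
        (\<forall>i j. 1 \<le> i \<and> i < j \<and> j \<le> k \<longrightarrow> b i + b j \<in> A))"

definition forces_pairwise_sums :: "nat \<Rightarrow> nat \<Rightarrow> int \<Rightarrow> bool" where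
  "forces_pairwise_sums k n m \<longleftrightarrow>
     (\<forall>A. A \<subseteq> {1..2 * int n} \<and> int (card A) \<ge> int n + m \<longrightarrow> has_pairwise_sums k A)"

(* The minimum ranges over all integers, negative ones included. *)
definition g :: "nat \<Rightarrow> nat \<Rightarrow> int" where
  "g k n = (LEAST m. forces_pairwise_sums k n m)"

(* LEAST on int is meaningful only if the minimum is attained; for k >= 2 it is:
   m = n + 1 works vacuously, and m <= -n fails because of the empty set. *)
lemma g_is_minimum:
  assumes "k \<ge> 2"
  shows "forces_pairwise_sums k n (g k n)"
    and "\<And>m. forces_pairwise_sums k n m \<Longrightarrow> g k n \<le> m"
proof -
  let ?P = "forces_pairwise_sums k n"
  have top: "?P (int n + 1)"
    unfolding forces_pairwise_sums_def
  proof (intro allI impI)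
    fix A :: "int set"
    assume A: "A \<subseteq> {1..2 * int n} \<and> int n + (int n + 1) \<le> int (card A)"
    then have "card A \<le> card {1..2 * int n}"
      by (intro card_mono) auto
    then have "int (card A) \<le> 2 * int n" by simp
    with A show "has_pairwise_sums k A" by linarith
  qed
  have no_empty: "\<not> has_pairwise_sums k {}"
  proof
    assume "has_pairwise_sums k {}"
    then obtain b :: "nat \<Rightarrow> int"
      where b: "\<And>i j. 1 \<le> i \<and> i < j \<and> j \<le> k \<Longrightarrow> b i + b j \<in> {}"
      unfolding has_pairwise_sums_def by blast
    show False using b[of 1 2] assms by simp
  qed
  have low: "- int n < m" if "?P m" for m
  proof (rule ccontr)
    assume "\<not> - int n < m"
    then have "has_pairwise_sums k {}"
      using that unfolding forces_pairwise_sums_def by simp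
    with no_empty show False by simp
  qed
  define d where "d = (LEAST d. ?P (int d - int n))"
  have "?P (int (2 * n + 1) - int n)" using top by (simp add: algebra_simps)
  then have d: "?P (int d - int n)"
    unfolding d_def by (rule LeastI)
  have min: "int d - int n \<le> m" if "?P m" for m
  proof -
    have eq: "int (nat (m + int n)) - int n = m" using low[OF that] by simp
    then have "d \<le> nat (m + int n)"
      unfolding d_def using that by (intro Least_le) simp
    with eq show ?thesis by linarith
  qed
  have "g k n = int d - int n"
    unfolding g_def using d min by (rule Least_equality)
  with d min show "?P (g k n)" and "\<And>m. ?P m \<Longrightarrow> g k n \<le> m" by auto
qed

end

(* The pairwise sums of three distinct integers are three distinct integers with even sum, and
   conversely any three distinct integers x, y, z with x + y + z = 2s are the pairwise sums of
   s - z, s - y, s - x.  The odd numbers contain no such triple.  A set with more than n elements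
   contains an even number, and either three even numbers or, since n \<ge> 3, two odd ones. *)
theory Submission
  imports Defs
begin

text \<open>The three pairwise sums total twice \<open>b 1 + b 2 + b 3\<close>, and they determine
  \<open>b\<close> because the system is invertible up to this parity condition. Since the
  \<open>b i\<close> may be any integers, the search for \<open>b\<close> becomes a question about
  parities in \<open>A\<close> alone.\<close>

lemma has_pairwise_sums_3_iff:
  "has_pairwise_sums 3 A \<longleftrightarrow>
     (\<exists>x\<in>A. \<exists>y\<in>A. \<exists>z\<in>A. x \<noteq> y \<and> x \<noteq> z \<and> y \<noteq> z \<and> even (x + y + z))"
proof
  assume "has_pairwise_sums 3 A"
  then obtain b :: "nat \<Rightarrow> int" where inj: "inj_on b {1..3}"
    and sums: "\<And>i j. 1 \<le> i \<and> i < j \<and> j \<le> 3 \<Longrightarrow> b i + b j \<in> A"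
    unfolding has_pairwise_sums_def by blast
  have "b 1 \<noteq> b 2" "b 1 \<noteq> b 3" "b 2 \<noteq> b 3"
    by (simp_all add: inj_on_eq_iff[OF inj])
  moreover have "b 1 + b 2 \<in> A" "b 1 + b 3 \<in> A" "b 2 + b 3 \<in> A"
    by (simp_all add: sums)
  moreover have "even ((b 1 + b 2) + (b 1 + b 3) + (b 2 + b 3))"
    by simp
  ultimately show "\<exists>x\<in>A. \<exists>y\<in>A. \<exists>z\<in>A. x \<noteq> y \<and> x \<noteq> z \<and> y \<noteq> z \<and> even (x + y + z)"
    by (intro bexI[of _ "b 1 + b 2"] bexI[of _ "b 1 + b 3"] bexI[of _ "b 2 + b 3"]) auto
next
  assume "\<exists>x\<in>A. \<exists>y\<in>A. \<exists>z\<in>A. x \<noteq> y \<and> x \<noteq> z \<and> y \<noteq> z \<and> even (x + y + z)"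
  then obtain x y z s where A: "x \<in> A" "y \<in> A" "z \<in> A"
    and neq: "x \<noteq> y" "x \<noteq> z" "y \<noteq> z" and s: "x + y + z = 2 * s"
    by (meson evenE)
  \<comment> \<open>Here \<open>s\<close> is to be the total \<open>b 1 + b 2 + b 3\<close>, so each
    entry is \<open>s\<close> minus the pairwise sum that omits it.\<close>
  define b :: "nat \<Rightarrow> int" where
    "b i = (if i = 1 then s - z else if i = 2 then s - y else s - x)" for i
  have set3: "{1..3} = {1, 2, 3 :: nat}"
    by auto
  have "inj_on b {1..3}"
    unfolding set3 using neq by (simp add: b_def)
  moreover have "b i + b j \<in> A" if ij: "1 \<le> i \<and> i < j \<and> j \<le> 3" for i j
  proof -
    have "b 1 + b 2 = x" "b 1 + b 3 = y" "b 2 + b 3 = z"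
      using s by (simp_all add: b_def)
    moreover have "i = 1 \<and> j = 2 \<or> i = 1 \<and> j = 3 \<or> i = 2 \<and> j = 3"
      using ij by arith
    ultimately show ?thesis
      using A by auto
  qed
  ultimately show "has_pairwise_sums 3 A"
    unfolding has_pairwise_sums_def by blast
qed

text \<open>This count serves both bounds: it caps the odd part of a large set, and it is the size
  of the extremal example.\<close>

lemma card_odd_atLeastAtMost: "card {x \<in> {1..2 * int n}. odd x} = n"
proof -
  have "{x \<in> {1..2 * int n}. odd x} = (\<lambda>i. 2 * i + 1) ` {0..<int n}"
    by (auto elim!: oddE)
  then show ?thesis
    by (simp add: card_image inj_on_def)
qed

theorem theorem1:
  fixes n :: nat
  assumes "n \<ge> 3"
  shows "g 3 n = 1"
proof (rule antisym)
  have "forces_pairwise_sums 3 n 1"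
    unfolding forces_pairwise_sums_def
  proof (intro allI impI)
    fix A :: "int set"
    assume "A \<subseteq> {1..2 * int n} \<and> int n + 1 \<le> int (card A)"
    then have sub: "A \<subseteq> {1..2 * int n}" and card: "n + 1 \<le> card A"
      by auto
    have fin: "finite A"
      using sub finite_subset by blast
    define E where "E = {x \<in> A. even x}"
    define D where "D = {x \<in> A. odd x}"
    have "card A = card E + card D"
      unfolding E_def D_def
      by (subst card_Un_disjoint[symmetric]) (auto simp: fin intro: arg_cong[where f = card])
    moreover have "card D \<le> n"
      unfolding D_def using sub
      by (subst card_odd_atLeastAtMost[of n, symmetric], intro card_mono) (auto intro: finite_subset[of _ "{1..2 * int n}"])
    \<comment> \<open>At most \<open>n\<close> of the \<open>n + 1\<close> or more elements are odd,
      so \<open>E\<close> is nonempty. If \<open>E\<close> has at most two elements, then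
      \<open>D\<close> has at least \<open>n - 1\<close>, which is at least 2 because
      \<open>n \<ge> 3\<close>.\<close>
    ultimately consider "3 \<le> card E" | "1 \<le> card E" "2 \<le> card D"
      using card assms by linarith
    then show "has_pairwise_sums 3 A"
    proof cases
      case 1
      then obtain B where "B \<subseteq> E" "card B = 3"
        by (meson obtain_subset_with_card_n)
      then obtain x y z where "{x, y, z} \<subseteq> E" "x \<noteq> y" "x \<noteq> z" "y \<noteq> z"
        by (auto simp: card_3_iff)
      then show ?thesis
        unfolding has_pairwise_sums_3_iff E_def
        by (intro bexI[of _ x] bexI[of _ y] bexI[of _ z]) auto
    next
      case 2
      then obtain B where "B \<subseteq> D" "card B = 2"
        by (meson obtain_subset_with_card_n)
      then obtain y z where "{y, z} \<subseteq> D" "y \<noteq> z"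
        by (auto simp: card_2_iff)
      moreover obtain x where "x \<in> E"
        using 2 by fastforce
      \<comment> \<open>The even \<open>x\<close> differs from the odd \<open>y\<close> and
        \<open>z\<close> by parity.\<close>
      ultimately show ?thesis
        unfolding has_pairwise_sums_3_iff E_def D_def
        by (intro bexI[of _ x] bexI[of _ y] bexI[of _ z]) auto
    qed
  qed
  then show "g 3 n \<le> 1"
    by (intro g_is_minimum) auto
next
  \<comment> \<open>Extremal example: three odd numbers have an odd sum, so these \<open>n\<close>
    elements rule out every threshold \<open>m \<le> 0\<close>.\<close>
  let ?D = "{x \<in> {1..2 * int n}. odd x}"
  have "forces_pairwise_sums 3 n (g 3 n)"
    by (rule g_is_minimum) simp
  moreover have "\<not> has_pairwise_sums 3 ?D"
    unfolding has_pairwise_sums_3_iff by auto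
  moreover have "?D \<subseteq> {1..2 * int n}"
    by auto
  ultimately have "\<not> int n + g 3 n \<le> int (card ?D)"
    unfolding forces_pairwise_sums_def by blast
  then show "1 \<le> g 3 n"
    unfolding card_odd_atLeastAtMost by simp
qed

end
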